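(* For each $n\in N$ let $\mathcal{D}_n$ be a coherent set of desirable gambles on $\mathcal{X}_n$, and let $R$ be any subset of $N$. Then $\mathrm{marg}_R(\otimes_{n\in N}\mathcal{D}_n)=\otimes_{r\in R}\mathcal{D}_r$.
   Context: Let $N$ be a finite non-empty index set, and for each $n\in N$ let $\mathcal{X}_n$ be a finite non-empty set. For $R\subseteq N$ let $\mathcal{X}_R:=\prod_{r\in R}\mathcal{X}_r$, with $\mathcal{X}_\emptyset$ a one-point set. Subsets of $N$ are allowed to be empty. For a finite non-empty set $\mathcal{Z}$, a gamble on $\mathcal{Z}$ is a function $\mathcal{Z}\to\mathbb{R}$; $\mathcal{G}(\mathcal{Z})$ is the linear space of all gambles on $\mathcal{Z}$. Write $f\geq g$ for pointwise inequality and $f>g$ if $f\geq g$ and $f\neq g$; $\mathcal{G}(\mathcal{Z})_{>0}:=\{f\in\mathcal{G}(\mathcal{Z}):f>0\}$. For $\mathcal{A}\subseteq\mathcal{G}(\mathcal{Z})$, $\mathrm{posi}(\mathcal{A}):=\{\sum_{k=1}^{m}\lambda_kf_k : m\geq 1,\ f_k\in\mathcal{A},\ \lambda_k>0\}$. A set of desirable gambles $\mathcal{D}\subseteq\mathcal{G}(\mathcal{Z})$ is coherent if (D1) $0\notin\mathcal{D}$; (D2) $\mathcal{G}(\mathcal{Z})_{>0}\subseteq\mathcal{D}$; (D3) $\mathrm{posi}(\mathcal{D})=\mathcal{D}$. For $R\subseteq S\subseteq N$, a gamble $f$ on $\mathcal{X}_R$ is identified with its cylindrical extension $x_S\mapsto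 f(x_R)$ on $\mathcal{X}_S$; $\mathbb{I}_{\{x_R\}}$ denotes the indicator of $x_R\in\mathcal{X}_R$ (identified in the same way with a gamble on $\mathcal{X}_S$). For $\mathcal{D}\subseteq\mathcal{G}(\mathcal{X}_N)$ and $R\subseteq N$, $\mathrm{marg}_R(\mathcal{D}):=\mathcal{D}\cap\mathcal{G}(\mathcal{X}_R)$. For $R\subseteq N$ and coherent $\mathcal{D}_r\subseteq\mathcal{G}(\mathcal{X}_r)$, $r\in R$, define $$\otimes_{r\in R}\mathcal{D}_r:=\mathrm{posi}\Big(\mathcal{G}(\mathcal{X}_R)_{>0}\cup\bigcup_{r\in R}\mathrm{posi}\left(\{\mathbb{I}_{\{x_{R\setminus\{r\}}\}}g : g\in\mathcal{D}_r,\ x_{R\setminus\{r\}}\in\mathcal{X}_{R\setminus\{r\}}\}\right)\Big)$$ (for $R=\emptyset$ this is $\mathcal{G}(\mathcal{X}_\emptyset)_{>0}$). *)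

theory Defs
  imports Complex_Main "HOL-Library.FuncSet" "HOL-Library.Indicator_Function"
begin

(* A gamble on a set Z is represented by a total function that is 0 outside Z.
   This makes the representation unique, and the gambles on Z are then closed under
   the pointwise linear operations. *)
definition gambles :: "'z set \<Rightarrow> ('z \<Rightarrow> real) set" where
  "gambles Z = {f. \<forall>z. z \<notin> Z \<longrightarrow> f z = 0}"

(* On functions, f < g is the pointwise order together with f \<noteq> g. *)
definition pos_gambles :: "'z set \<Rightarrow> ('z \<Rightarrow> real) set" where
  "pos_gambles Z = {f \<in> gambles Z. (\<lambda>_. 0) < f}"

definition posi :: "('z \<Rightarrow> real) set \<Rightarrow> ('z \<Rightarrow> real) set" where
  "posi A = {h. \<exists>(m::nat) (c :: nat \<Rightarrow> real) (f :: nat \<Rightarrow> 'z \<Rightarrow> real).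
     1 \<le> m \<and> (\<forall>k\<in>{1..m}. f k \<in> A \<and> 0 < c k) \<and> h = (\<lambda>z. \<Sum>k=1..m. c k * f k z)}"

definition coherent :: "'z set \<Rightarrow> ('z \<Rightarrow> real) set \<Rightarrow> bool" where
  "coherent Z D \<longleftrightarrow>
     D \<subseteq> gambles Z \<and> (\<lambda>_. 0) \<notin> D \<and> pos_gambles Z \<subseteq> D \<and> posi D = D"

(* The joint space of the variables in R is the set PiE R X of extensional functions;
   PiE {} X has exactly one element. *)

(* Cylindrical extension to PiE S X of a gamble on PiE R X, for R \<subseteq> S. *)
definition cyl :: "('i \<Rightarrow> 'a set) \<Rightarrow> 'i set \<Rightarrow> 'i set \<Rightarrow> (('i \<Rightarrow> 'a) \<Rightarrow> real) \<Rightarrow> ('i \<Rightarrow> 'a) \<Rightarrow> real"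
  where "cyl X R S f = (\<lambda>x. if x \<in> PiE S X then f (restrict x R) else 0)"

(* For D a set of gambles on PiE N X: the intersection of D with the gambles on PiE R X,
   where the latter are identified with their cylindrical extensions; the result is
   given as a set of gambles on PiE R X itself. *)
definition marg ::
  "('i \<Rightarrow> 'a set) \<Rightarrow> 'i set \<Rightarrow> 'i set \<Rightarrow> (('i \<Rightarrow> 'a) \<Rightarrow> real) set \<Rightarrow> (('i \<Rightarrow> 'a) \<Rightarrow> real) set" where
  "marg X N R D = {f \<in> gambles (PiE R X). cyl X R N f \<in> D}"

(* A local gamble g on X r acts on the joint space through the coordinate x r; the
   indicator factor makes the product vanish outside PiE R X. *)
definition indep_prod ::
  "('i \<Rightarrow> 'a set) \<Rightarrow> 'i set \<Rightarrow> ('i \<Rightarrow> ('a \<Rightarrow> real) set) \<Rightarrow> (('i \<Rightarrow> 'a) \<Rightarrow> real) set" where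
  "indep_prod X R D =
     posi (pos_gambles (PiE R X) \<union>
       (\<Union>r\<in>R. posi {(\<lambda>x. cyl X (R - {r}) R (indicator {y}) x * g (x r)) | g y.
          g \<in> D r \<and> y \<in> PiE (R - {r}) X}))"

end

theory Submission
  imports Defs
begin

text \<open>
  Variables outside \<open>R\<close> are removed one at a time. To remove \<open>n\<close>, average over \<open>X n\<close> with a
  probability mass function \<open>p\<close>: this maps the cylindrical extension of \<open>f\<close> back to \<open>f\<close>, and maps
  the generators of the product to generators of the smaller product, up to a positive factor,
  except that an indicator times \<open>g \<in> D n\<close> becomes an indicator times the expectation of \<open>g\<close>.
  A coherent \<open>D n\<close> need not be described by a single \<open>p\<close>, but any given element of the product
  involves only finitely many \<open>g \<in> D n\<close>, and for these Gordan's theorem of the alternative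
  provides a strictly positive \<open>p\<close> under which all of them have positive expectation.
\<close>

subsection \<open>Positive hulls\<close>

lemma posiI:
  fixes m :: nat
  assumes "1 \<le> m" "\<And>k. k \<in> {1..m} \<Longrightarrow> f k \<in> A \<and> 0 < c k"
  shows "(\<lambda>z. \<Sum>k=1..m. c k * f k z) \<in> posi A"
  unfolding posi_def
  by (rule CollectI, rule exI[of _ m], rule exI[of _ c], rule exI[of _ f]) (use assms in simp)

lemma posi_base: "f \<in> A \<Longrightarrow> f \<in> posi A"
  using posiI[of 1 "\<lambda>_. f" A "\<lambda>_. 1"] by simp

lemma posi_scale:
  assumes "f \<in> posi A" "0 < c"
  shows "(\<lambda>z. c * f z) \<in> posi A"
proof -
  obtain m :: nat and d h where m: "1 \<le> m" "\<forall>k\<in>{1..m}. h k \<in> A \<and> 0 < d k"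
      and f: "f = (\<lambda>z. \<Sum>k=1..m. d k * h k z)"
    using assms(1) unfolding posi_def by blast
  have "(\<lambda>z. c * f z) = (\<lambda>z. \<Sum>k=1..m. (c * d k) * h k z)"
    by (simp add: f sum_distrib_left mult.assoc)
  also have "\<dots> \<in> posi A"
    by (rule posiI) (use m assms(2) in \<open>simp_all add: zero_less_mult_iff\<close>)
  finally show ?thesis .
qed

lemma posi_add:
  assumes "f \<in> posi A" "g \<in> posi A"
  shows "(\<lambda>z. f z + g z) \<in> posi A"
proof -
  obtain m :: nat and d h where m: "1 \<le> m" "\<forall>k\<in>{1..m}. h k \<in> A \<and> 0 < d k"
      and f: "f = (\<lambda>z. \<Sum>k=1..m. d k * h k z)"
    using assms(1) unfolding posi_def by blast
  obtain m' :: nat and d' h' where m': "1 \<le> m'" "\<forall>k\<in>{1..m'}. h' k \<in> A \<and> 0 < d' k"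
      and g: "g = (\<lambda>z. \<Sum>k=1..m'. d' k * h' k z)"
    using assms(2) unfolding posi_def by blast
  define e where "e k = (if k \<le> m then d k else d' (k - m))" for k
  define l where "l k = (if k \<le> m then h k else h' (k - m))" for k
  have "(\<Sum>k=1..m+m'. e k * l k z) = f z + g z" for z
  proof -
    have "(\<Sum>k=1..m+m'. e k * l k z) =
        (\<Sum>k=1..m. e k * l k z) + (\<Sum>k=1+m..m'+m. e k * l k z)"
      by (subst sum.ub_add_nat) (auto simp: add.commute)
    also have "(\<Sum>k=1+m..m'+m. e k * l k z) = (\<Sum>k=1..m'. e (k + m) * l (k + m) z)"
      by (rule sum.shift_bounds_cl_nat_ivl)
    finally show ?thesis
      by (simp add: e_def l_def f g)
  qed
  then have "(\<lambda>z. f z + g z) = (\<lambda>z. \<Sum>k=1..m+m'. e k * l k z)"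
    by simp
  also have "\<dots> \<in> posi A"
  proof (rule posiI)
    fix k assume k: "k \<in> {1..m+m'}"
    then have "k - m \<in> {1..m'}" if "\<not> k \<le> m"
      using that by auto
    then show "l k \<in> A \<and> 0 < e k"
      using k m(2) m'(2) by (cases "k \<le> m") (simp_all add: l_def e_def)
  qed (use m(1) in simp)
  finally show ?thesis .
qed

text \<open>Replaces explicit sums by closure under addition and positive scaling. The inner
  induction on the number of terms starts at 1, because the empty sum would be the zero
  gamble.\<close>

lemma posi_induct [consumes 1, case_names base add scale]:
  assumes "h \<in> posi A"
    and base: "\<And>f. f \<in> A \<Longrightarrow> P f"
    and add: "\<And>f g. P f \<Longrightarrow> P g \<Longrightarrow> P (\<lambda>z. f z + g z)"
    and scale: "\<And>c f. (0::real) < c \<Longrightarrow> P f \<Longrightarrow> P (\<lambda>z. c * f z)"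
  shows "P h"
proof -
  obtain m :: nat and d l where m: "1 \<le> m" "\<forall>k\<in>{1..m}. l k \<in> A \<and> 0 < d k"
      and h: "h = (\<lambda>z. \<Sum>k=1..m. d k * l k z)"
    using assms(1) unfolding posi_def by blast
  from m have "P (\<lambda>z. \<Sum>k=1..m. d k * l k z)"
  proof (induction m rule: dec_induct)
    case base
    then show ?case by (simp add: assms(2) scale)
  next
    case (step k)
    then have "P (\<lambda>z. d (Suc k) * l (Suc k) z)"
      by (intro scale assms(2)) auto
    with step have "P (\<lambda>z. (\<Sum>k=1..k. d k * l k z) + d (Suc k) * l (Suc k) z)"
      by (intro add[of "\<lambda>z. \<Sum>k=1..k. d k * l k z"]) auto
    then show ?case by simp
  qed
  then show ?thesis by (simp add: h)
qed

lemma posi_subset: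
  assumes "A \<subseteq> posi B"
  shows "posi A \<subseteq> posi B"
proof
  fix h assume "h \<in> posi A"
  then show "h \<in> posi B"
    by (induction rule: posi_induct) (use assms in \<open>auto intro: posi_add posi_scale\<close>)
qed

lemma posi_mono: "A \<subseteq> B \<Longrightarrow> posi A \<subseteq> posi B"
  by (rule posi_subset) (auto intro: posi_base)

lemma posi_sum:
  assumes "finite I" "I \<noteq> {}" "\<And>i. i \<in> I \<Longrightarrow> f i \<in> posi A"
  shows "(\<lambda>z. \<Sum>i\<in>I. f i z) \<in> posi A"
  using assms by (induction I rule: finite_ne_induct) (auto intro: posi_add)

lemma pos_gambles_iff:
  "f \<in> pos_gambles Z \<longleftrightarrow> f \<in> gambles Z \<and> (\<forall>z\<in>Z. 0 \<le> f z) \<and> (\<exists>z\<in>Z. 0 < f z)"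
proof -
  have "(\<lambda>_. 0) < f \<longleftrightarrow> (\<forall>z\<in>Z. 0 \<le> f z) \<and> (\<exists>z\<in>Z. 0 < f z)" if "f \<in> gambles Z"
  proof -
    have "f z = 0" if "z \<notin> Z" for z
      using that \<open>f \<in> gambles Z\<close> by (simp add: gambles_def)
    then show ?thesis
      by (force simp: less_fun_def le_fun_def not_le)
  qed
  then show ?thesis
    by (auto simp: pos_gambles_def)
qed

subsection \<open>Gordan's theorem\<close>

text \<open>Each expression tends to \<open>a g > 0\<close> as \<open>e\<close> decreases to 0, and
  finitely many conditions that hold eventually hold together.\<close>

lemma small_perturbation_pos:
  fixes a b :: "'b \<Rightarrow> real"
  assumes "finite G" "\<And>g. g \<in> G \<Longrightarrow> 0 < a g"
  shows "\<exists>e>0. \<forall>g\<in>G. 0 < a g + e * b g"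
proof -
  have "\<forall>\<^sub>F e in at_right 0. \<forall>g\<in>G. 0 < a g + e * b g"
  proof (intro eventually_ball_finite assms(1) ballI)
    fix g assume "g \<in> G"
    have "((\<lambda>e. a g + e * b g) \<longlongrightarrow> a g + 0 * b g) (at_right 0)"
      by (intro tendsto_intros)
    then show "\<forall>\<^sub>F e in at_right 0. 0 < a g + e * b g"
      by (rule order_tendstoD) (use assms(2)[OF \<open>g \<in> G\<close>] in simp)
  qed
  then have "\<forall>\<^sub>F e in at_right 0. 0 < e \<and> (\<forall>g\<in>G. 0 < a g + e * b g)"
    by (rule eventually_conj[OF eventually_at_right_less])
  then show ?thesis
    by (rule eventually_happens'[OF trivial_limit_at_right_real])
qed

text \<open>One vector \<open>h\<close> is split off, and a solution \<open>p\<close> for the others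
  is corrected according to the sign of its pairing with \<open>h\<close>. The induction is on the
  cardinality because the last case applies the hypothesis to projected vectors, which need not lie
  in \<open>G\<close>.\<close>

lemma gordan:
  assumes "finite Z" "finite G" "G \<subseteq> gambles Z" "(\<lambda>_. 0) \<notin> posi G"
  shows "\<exists>p. \<forall>g\<in>G. 0 < (\<Sum>z\<in>Z. p z * g z)"
  using assms(2-4)
proof (induction "card G" arbitrary: G rule: less_induct)
  case less
  define ip :: "('a \<Rightarrow> real) \<Rightarrow> ('a \<Rightarrow> real) \<Rightarrow> real" where "ip p g = (\<Sum>z\<in>Z. p z * g z)" for p g
  have ip_left: "ip (\<lambda>z. q z + t * p z) g = ip q g + t * ip p g" for q t p g
    by (simp add: ip_def algebra_simps sum.distrib sum_distrib_left)
  have ip_right: "ip g (\<lambda>z. q z + t * p z) = ip g q + t * ip g p" for q t p g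
    by (simp add: ip_def algebra_simps sum.distrib sum_distrib_left)
  show ?case
  proof (cases "G = {}")
    case True
    then show ?thesis by simp
  next
    case False
    then obtain h H where G: "G = insert h H" "h \<notin> H"
      by (meson all_not_in_conv mk_disjoint_insert)
    have H: "finite H" "H \<subseteq> gambles Z" "card H < card G"
      using less.prems G by auto
    have h: "h \<in> gambles Z" "h \<in> posi G" "H \<subseteq> posi G"
      using less.prems G by (auto intro: posi_base)
    have "(\<lambda>_. 0) \<notin> posi H"
      using posi_mono[of H G] less.prems G by auto
    with less.hyps[of H] G H obtain p where p: "\<And>g. g \<in> H \<Longrightarrow> 0 < ip p g"
      unfolding ip_def by auto
    consider "0 < ip p h" | "ip p h = 0" | "ip p h < 0" by linarith
    then show ?thesis
    proof cases
      case 1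
      then show ?thesis using p G unfolding ip_def by auto
    next
      case 2
      \<comment> \<open>Tilting \<open>p\<close> slightly towards \<open>h\<close> makes the value
        at \<open>h\<close> equal to \<open>e * ip h h\<close>. This is positive, since
        \<open>h\<close> lies in \<open>posi G\<close> and hence is not zero.\<close>
      obtain e where e: "0 < e" "\<And>g. g \<in> H \<Longrightarrow> 0 < ip p g + e * ip h g"
        using small_perturbation_pos[of H "ip p" "ip h"] H p by auto
      obtain z where "h z \<noteq> 0"
        using h(2) less.prems(3) by (metis ext)
      then have "0 < ip h h"
        unfolding ip_def using h(1) assms(1)
        by (intro sum_pos2[of _ z]) (auto simp: gambles_def zero_less_mult_iff)
      then have "\<forall>g\<in>G. 0 < ip (\<lambda>z. p z + e * h z) g"
        using e 2 G by (auto simp: ip_left)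
      then show ?thesis
        by (intro exI[of _ "\<lambda>z. p z + e * h z"]) (simp add: ip_def)
    next
      case 3
      \<comment> \<open>The multiple of \<open>h\<close> that cancels the value of \<open>p\<close>
        at \<open>g\<close>. It is positive because \<open>ip p h < 0\<close>, so \<open>g\<close>
        plus this multiple stays in \<open>posi G\<close>.\<close>
      define c where "c g = ip p g / - ip p h" for g
      have c: "0 < c g" if "g \<in> H" for g
        using p[OF that] 3 by (simp add: c_def field_simps)
      \<comment> \<open>Project along \<open>h\<close> onto the hyperplane \<open>ip p = 0\<close>; adding multiples of \<open>p\<close> to a solution \<open>q\<close> for
        the projected vectors then only changes the value at \<open>h\<close>, which is made small and positive.\<close>
      define \<pi> where "\<pi> g = (\<lambda>z. g z + c g * h z)" for g
      have \<pi>: "\<pi> g \<in> posi G" if "g \<in> H" for g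
        unfolding \<pi>_def using that c h by (intro posi_add posi_scale) auto
      have "\<exists>q. \<forall>g\<in>\<pi> ` H. 0 < ip q g"
      proof -
        have "posi (\<pi> ` H) \<subseteq> posi G"
          using \<pi> by (intro posi_subset) auto
        moreover have "\<pi> ` H \<subseteq> gambles Z"
          using H h by (auto simp: \<pi>_def gambles_def)
        moreover have "card (\<pi> ` H) < card G"
          using card_image_le[OF H(1), of \<pi>] H(3) by simp
        ultimately show ?thesis
          using less.hyps[of "\<pi> ` H"] H(1) less.prems unfolding ip_def by auto
      qed
      then obtain q where q: "\<And>g. g \<in> H \<Longrightarrow> 0 < ip q (\<pi> g)"
        by auto
      \<comment> \<open>The expression required to be positive will be the value at \<open>g\<close>
        of the final solution \<open>r\<close>. The scalar \<open>t\<close> below solves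
        \<open>ip q h + t * ip p h = e\<close>.\<close>
      obtain e where e: "0 < e" "\<And>g. g \<in> H \<Longrightarrow> 0 < ip q (\<pi> g) + e * - c g"
        using small_perturbation_pos[of H "\<lambda>g. ip q (\<pi> g)" "\<lambda>g. - c g"] H q by auto
      define t where "t = (e - ip q h) / ip p h"
      define r where "r = (\<lambda>z. q z + t * p z)"
      have rh: "ip r h = e"
        using 3 by (simp add: r_def ip_left) (simp add: t_def)
      have "0 < ip r g" if "g \<in> H" for g
      proof -
        have "ip p (\<pi> g) = 0"
          using 3 by (simp add: \<pi>_def ip_right) (simp add: c_def)
        then have "ip q (\<pi> g) = ip r (\<pi> g)"
          by (simp add: r_def ip_left)
        also have "\<dots> = ip r g + e * c g"
          by (simp add: \<pi>_def ip_right rh)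
        finally show ?thesis
          using e(2)[OF that] by simp
      qed
      then have "\<forall>g\<in>G. 0 < ip r g"
        using rh e(1) G by auto
      then show ?thesis
        by (intro exI[of _ r]) (simp add: ip_def)
    qed
  qed
qed

text \<open>Gordan's theorem is applied to \<open>G\<close> together with the indicators of points.
  Coherence puts these in \<open>D\<close> and keeps 0 out of the positive hull. Positive
  expectation of an indicator is positive mass at its point, and dividing by the total mass gives
  sum 1.\<close>

lemma coherent_mass_function:
  assumes "finite Z" "Z \<noteq> {}" "coherent Z D" "finite G" "G \<subseteq> D"
  shows "\<exists>p. (\<forall>z\<in>Z. 0 < p z) \<and> (\<Sum>z\<in>Z. p z) = 1 \<and> (\<forall>g\<in>G. 0 < (\<Sum>z\<in>Z. p z * g z))"
proof -
  define I :: "('a \<Rightarrow> real) set" where "I = (\<lambda>z. indicator {z}) ` Z"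
  have "I \<subseteq> pos_gambles Z"
    by (auto simp: I_def pos_gambles_iff gambles_def indicator_def)
  then have GI: "G \<union> I \<subseteq> D"
    using assms by (auto simp: coherent_def)
  have "(\<lambda>_. 0) \<notin> posi (G \<union> I)"
    using posi_mono[OF GI] assms(3) by (auto simp: coherent_def)
  moreover have "G \<union> I \<subseteq> gambles Z"
    using GI assms(3) by (auto simp: coherent_def)
  moreover have "finite (G \<union> I)"
    using assms by (simp add: I_def)
  ultimately obtain p where p: "\<And>g. g \<in> G \<union> I \<Longrightarrow> 0 < (\<Sum>z\<in>Z. p z * g z)"
    using gordan[OF assms(1), of "G \<union> I"] by blast
  have pos: "0 < p z" if "z \<in> Z" for z
    using p[of "indicator {z}"] that assms(1) by (simp add: I_def indicator_def)
  define s where "s = (\<Sum>z\<in>Z. p z)"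
  have s: "0 < s"
    unfolding s_def using assms pos by (intro sum_pos) auto
  have "(\<Sum>z\<in>Z. p z / s) = 1"
    using s by (simp add: s_def flip: sum_divide_distrib)
  moreover have "0 < (\<Sum>z\<in>Z. p z / s * g z)" if "g \<in> G" for g
    using p[of g] s that by (simp flip: sum_divide_distrib)
  ultimately show ?thesis
    using pos s by (intro exI[of _ "\<lambda>z. p z / s"]) auto
qed

subsection \<open>Removing one variable\<close>

text \<open>The product of the indicator of \<open>y\<close> with \<open>g\<close>, written as a
  single case distinction.\<close>

definition slice ::
  "('i \<Rightarrow> 'a set) \<Rightarrow> 'i set \<Rightarrow> 'i \<Rightarrow> ('i \<Rightarrow> 'a) \<Rightarrow> ('a \<Rightarrow> real) \<Rightarrow> ('i \<Rightarrow> 'a) \<Rightarrow> real" where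
  "slice X R r y g = (\<lambda>x. if x \<in> PiE R X \<and> restrict x (R - {r}) = y then g (x r) else 0)"

definition generators ::
  "('i \<Rightarrow> 'a set) \<Rightarrow> 'i set \<Rightarrow> ('i \<Rightarrow> ('a \<Rightarrow> real) set) \<Rightarrow> (('i \<Rightarrow> 'a) \<Rightarrow> real) set" where
  "generators X R D = pos_gambles (PiE R X) \<union>
     {slice X R r y g | r y g. r \<in> R \<and> y \<in> PiE (R - {r}) X \<and> g \<in> D r}"

text \<open>The outer positive hull absorbs the inner ones, which leaves only two kinds of
  generators to treat in inductions.\<close>

lemma indep_prod_eq_posi_generators: "indep_prod X R D = posi (generators X R D)"
proof -
  have slice: "(\<lambda>x. cyl X (R - {r}) R (indicator {y}) x * g (x r)) = slice X R r y g" for r y g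
    by (auto simp: cyl_def slice_def indicator_def)
  define A where "A r = {slice X R r y g | g y. g \<in> D r \<and> y \<in> PiE (R - {r}) X}" for r
  have prod: "indep_prod X R D = posi (pos_gambles (PiE R X) \<union> (\<Union>r\<in>R. posi (A r)))"
    by (simp add: indep_prod_def slice A_def)
  have gens: "generators X R D = pos_gambles (PiE R X) \<union> (\<Union>r\<in>R. A r)"
    by (auto simp: generators_def A_def)
  have "posi (A r) \<subseteq> posi (generators X R D)" if "r \<in> R" for r
    using that by (intro posi_mono) (auto simp: gens)
  then have "indep_prod X R D \<subseteq> posi (generators X R D)"
    unfolding prod by (intro posi_subset) (auto simp: gens intro: posi_base)
  moreover have "posi (generators X R D) \<subseteq> indep_prod X R D"
    unfolding prod by (intro posi_mono) (auto simp: gens intro: posi_base)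
  ultimately show ?thesis by simp
qed

lemma pos_gambles_indep_prod: "f \<in> pos_gambles (PiE R X) \<Longrightarrow> f \<in> indep_prod X R D"
  unfolding indep_prod_eq_posi_generators by (rule posi_base) (simp add: generators_def)

lemma slice_indep_prod:
  assumes "r \<in> R" "y \<in> PiE (R - {r}) X" "g \<in> D r"
  shows "slice X R r y g \<in> indep_prod X R D"
  unfolding indep_prod_eq_posi_generators generators_def
  by (intro posi_base UnI2 CollectI exI[of _ r] exI[of _ y] exI[of _ g] conjI refl assms)

lemma indep_prod_add:
  "f \<in> indep_prod X R D \<Longrightarrow> g \<in> indep_prod X R D \<Longrightarrow> (\<lambda>z. f z + g z) \<in> indep_prod X R D"
  unfolding indep_prod_eq_posi_generators by (rule posi_add)

lemma indep_prod_scale: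
  "f \<in> indep_prod X R D \<Longrightarrow> 0 < c \<Longrightarrow> (\<lambda>z. c * f z) \<in> indep_prod X R D"
  unfolding indep_prod_eq_posi_generators by (rule posi_scale)

lemma indep_prod_induct [consumes 1, case_names pos slice add scale]:
  assumes "f \<in> indep_prod X R D"
    and "\<And>f. f \<in> pos_gambles (PiE R X) \<Longrightarrow> P f"
    and "\<And>r y g. r \<in> R \<Longrightarrow> y \<in> PiE (R - {r}) X \<Longrightarrow> g \<in> D r \<Longrightarrow> P (slice X R r y g)"
    and "\<And>f g. P f \<Longrightarrow> P g \<Longrightarrow> P (\<lambda>z. f z + g z)"
    and "\<And>c f. (0::real) < c \<Longrightarrow> P f \<Longrightarrow> P (\<lambda>z. c * f z)"
  shows "P f"
  using assms(1) unfolding indep_prod_eq_posi_generators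
proof (induction rule: posi_induct)
  case (base f)
  then consider "f \<in> pos_gambles (PiE R X)"
    | r y g where "r \<in> R" "y \<in> PiE (R - {r}) X" "g \<in> D r" "f = slice X R r y g"
    by (auto simp: generators_def)
  then show ?case
    by cases (simp_all add: assms(2,3))
next
  case (add f g)
  then show ?case by (rule assms(4))
next
  case (scale c f)
  then show ?case by (rule assms(5))
qed

lemma indep_prod_gambles: "indep_prod X R D \<subseteq> gambles (PiE R X)"
proof
  fix f assume "f \<in> indep_prod X R D"
  then show "f \<in> gambles (PiE R X)"
    by (induction rule: indep_prod_induct) (auto simp: pos_gambles_def slice_def gambles_def)
qed

section \<open>Integrating out one variable\<close>

definition average ::
  "('i \<Rightarrow> 'a set) \<Rightarrow> 'i set \<Rightarrow> 'i \<Rightarrow> ('a \<Rightarrow> real) \<Rightarrow> (('i \<Rightarrow> 'a) \<Rightarrow> real) \<Rightarrow> ('i \<Rightarrow> 'a) \<Rightarrow> real" where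
  "average X R n p f = (\<lambda>x. if x \<in> PiE R X then \<Sum>a\<in>X n. p a * f (x(n := a)) else 0)"

text \<open>The extension does not depend on coordinate \<open>n\<close>, so the weights factor out
  and sum to 1.\<close>

lemma average_cyl:
  assumes "n \<notin> R" "(\<Sum>a\<in>X n. p a) = 1" "f \<in> gambles (PiE R X)"
  shows "average X R n p (cyl X R (insert n R) f) = f"
proof
  fix x
  have "cyl X R (insert n R) f (x(n := a)) = f x" if "x \<in> PiE R X" "a \<in> X n" for a
    using that assms(1) by (auto simp: cyl_def PiE_fun_upd PiE_restrict)
  then show "average X R n p (cyl X R (insert n R) f) x = f x"
    using assms(2,3) by (auto simp: average_def gambles_def simp flip: sum_distrib_right)
qed

lemma average_pos_gambles:
  assumes "n \<notin> R" "finite (X n)" "\<And>a. a \<in> X n \<Longrightarrow> 0 < p a"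
    and f: "f \<in> pos_gambles (PiE (insert n R) X)"
  shows "average X R n p f \<in> pos_gambles (PiE R X)"
proof -
  have nonneg: "0 \<le> f z" for z
    using f by (cases "z \<in> PiE (insert n R) X") (auto simp: pos_gambles_iff gambles_def)
  obtain z where z: "z \<in> PiE (insert n R) X" "0 < f z"
    using f by (auto simp: pos_gambles_iff)
  then have zn: "z n \<in> X n" and zR: "restrict z R \<in> PiE R X"
    by auto
  \<comment> \<open>Hence \<open>f z\<close> occurs among the averaged values at
    \<open>restrict z R\<close>, with the positive weight \<open>p (z n)\<close>.\<close>
  have "(restrict z R)(n := z n) = z"
    using PiE_arb[OF z(1)] by (fastforce simp: fun_eq_iff)
  then have "0 < (\<Sum>a\<in>X n. p a * f ((restrict z R)(n := a)))"
    using zn z(2) assms(2,3) nonneg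
    by (intro sum_pos2[of _ "z n"]) (simp_all add: less_imp_le)
  then have "0 < average X R n p f (restrict z R)"
    using zR by (simp add: average_def)
  moreover have "\<forall>x. 0 \<le> average X R n p f x"
    unfolding average_def using assms(3) nonneg
    by (auto intro!: sum_nonneg mult_nonneg_nonneg simp: less_imp_le)
  moreover have "average X R n p f \<in> gambles (PiE R X)"
    by (simp add: gambles_def average_def)
  ultimately show ?thesis
    using zR unfolding pos_gambles_iff by blast
qed

text \<open>As \<open>r\<close> differs from \<open>n\<close>, the conditioning point
  \<open>y\<close> has an \<open>n\<close>-coordinate. The event splits into a condition on that
  coordinate and one on the rest.\<close>

lemma restrict_upd_eq_iff:
  assumes "n \<notin> R" "r \<in> R" "y \<in> PiE (insert n R - {r}) X"
  shows "restrict (x(n := a)) (insert n R - {r}) = y \<longleftrightarrow>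
    a = y n \<and> restrict x (R - {r}) = restrict y (R - {r})"
proof
  assume y: "restrict (x(n := a)) (insert n R - {r}) = y"
  have "restrict x (R - {r}) = restrict y (R - {r})"
    unfolding y[symmetric] using assms(1) by (auto simp: restrict_def fun_eq_iff)
  moreover have "a = y n"
    unfolding y[symmetric] using assms(1,2) by auto
  ultimately show "a = y n \<and> restrict x (R - {r}) = restrict y (R - {r})"
    by simp
next
  assume eq: "a = y n \<and> restrict x (R - {r}) = restrict y (R - {r})"
  show "restrict (x(n := a)) (insert n R - {r}) = y"
  proof
    fix i
    have "i \<in> R - {r} \<Longrightarrow> x i = y i"
      using eq by (metis restrict_apply')
    \<comment> \<open>Outside \<open>insert n R - {r}\<close> both sides are
      \<open>undefined\<close>, by extensionality of \<open>y\<close>.\<close>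
    then show "restrict (x(n := a)) (insert n R - {r}) i = y i"
      using eq assms(1,2) PiE_arb[OF assms(3), of i] by auto
  qed
qed

text \<open>The event fixes coordinate \<open>n\<close> to \<open>y n\<close>, so only one term of
  the average survives.\<close>

lemma average_slice_other:
  assumes "n \<notin> R" "finite (X n)" "r \<in> R" "y \<in> PiE (insert n R - {r}) X"
  shows "average X R n p (slice X (insert n R) r y g) =
    (\<lambda>x. p (y n) * slice X R r (restrict y (R - {r})) g x)"
proof
  fix x
  have yn: "y n \<in> X n"
    using assms by auto
  have "average X R n p (slice X (insert n R) r y g) x =
      (\<Sum>a\<in>X n. if a = y n then p (y n) * slice X R r (restrict y (R - {r})) g x else 0)"
    if x: "x \<in> PiE R X"
  proof -
    have "p a * slice X (insert n R) r y g (x(n := a)) =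
        (if a = y n then p (y n) * slice X R r (restrict y (R - {r})) g x else 0)"
      if "a \<in> X n" for a
    proof -
      have "x(n := a) \<in> PiE (insert n R) X"
        using x that by (rule PiE_fun_upd[rotated])
      moreover have "r \<noteq> n"
        using assms by auto
      ultimately show ?thesis
        using x restrict_upd_eq_iff[OF assms(1,3,4), of x a]
        by (simp add: slice_def)
    qed
    then show ?thesis
      using x by (simp add: average_def)
  qed
  then show "average X R n p (slice X (insert n R) r y g) x =
      p (y n) * slice X R r (restrict y (R - {r})) g x"
    using yn assms(2) by (cases "x \<in> PiE R X") (auto simp: average_def slice_def)
qed

text \<open>Here \<open>y\<close> fixes all of \<open>R\<close> and \<open>g\<close> acts on the
  averaged coordinate, so what remains is the indicator of \<open>y\<close> times the expectation of
  \<open>g\<close>.\<close>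

lemma average_slice_same:
  assumes "n \<notin> R" "y \<in> PiE R X"
  shows "average X R n p (slice X (insert n R) n y g) =
    (\<lambda>x. if x = y then \<Sum>a\<in>X n. p a * g a else 0)"
proof
  fix x
  have "restrict (x(n := a)) (insert n R - {n}) = x" if "x \<in> PiE R X" for a
    using PiE_arb[OF that] assms(1) by (fastforce simp: fun_eq_iff)
  then show "average X R n p (slice X (insert n R) n y g) x =
      (if x = y then \<Sum>a\<in>X n. p a * g a else 0)"
    using assms by (auto simp: average_def slice_def PiE_fun_upd intro!: sum.cong)
qed

text \<open>\<open>G\<close> collects the members of \<open>D n\<close> used in building
  \<open>f\<close>. It is chosen before \<open>p\<close>, so that \<open>p\<close> can afterwards be
  fitted to it.\<close>

lemma average_indep_prod:
  assumes "n \<notin> R" "finite (X n)" "f \<in> indep_prod X (insert n R) D"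
  shows "\<exists>G. finite G \<and> G \<subseteq> D n \<and>
    (\<forall>p. (\<forall>a\<in>X n. 0 < p a) \<longrightarrow> (\<forall>g\<in>G. 0 < (\<Sum>a\<in>X n. p a * g a)) \<longrightarrow>
      average X R n p f \<in> indep_prod X R D)"
  using assms(3)
proof (induction rule: indep_prod_induct)
  case (pos f)
  have "average X R n p f \<in> indep_prod X R D" if "\<forall>a\<in>X n. 0 < p a" for p
    using average_pos_gambles[of n R X p f] that assms(1,2) pos
    by (simp add: pos_gambles_indep_prod)
  then show ?case by blast
next
  case (slice r y g)
  show ?case
  proof (cases "r = n")
    case True
    then have y: "y \<in> PiE R X"
      using assms(1) slice by simp
    \<comment> \<open>The only generators that constrain the expectations under \<open>p\<close>: if
      \<open>g\<close> has positive expectation, the average is a positive gamble.\<close>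
    have "average X R n p (slice X (insert n R) r y g) \<in> indep_prod X R D"
      if "0 < (\<Sum>a\<in>X n. p a * g a)" for p
    proof (rule pos_gambles_indep_prod)
      show "average X R n p (slice X (insert n R) r y g) \<in> pos_gambles (PiE R X)"
        using average_slice_same[of n R y X p g] True assms(1) y that
        by (auto simp: pos_gambles_iff gambles_def)
    qed
    then show ?thesis
      using slice True by (intro exI[of _ "{g}"]) auto
  next
    case False
    then have r: "r \<in> R"
      using slice by simp
    then have "restrict y (R - {r}) \<in> PiE (R - {r}) X" "y n \<in> X n"
      using slice assms(1) by auto
    then have "average X R n p (slice X (insert n R) r y g) \<in> indep_prod X R D"
      if "\<forall>a\<in>X n. 0 < p a" for p
      unfolding average_slice_other[where X = X, OF assms(1,2) r slice(2)]
      using that r slice(3) by (intro indep_prod_scale slice_indep_prod) auto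
    then show ?thesis by blast
  qed
next
  case (add f g)
  have eq: "average X R n p (\<lambda>z. f z + g z) = (\<lambda>x. average X R n p f x + average X R n p g x)"
    for p
    by (auto simp: average_def algebra_simps sum.distrib)
  obtain G where G: "finite G" "G \<subseteq> D n" "\<forall>p. (\<forall>a\<in>X n. 0 < p a) \<longrightarrow>
      (\<forall>g\<in>G. 0 < (\<Sum>a\<in>X n. p a * g a)) \<longrightarrow> average X R n p f \<in> indep_prod X R D"
    using add(1) by (elim exE conjE)
  obtain G' where G': "finite G'" "G' \<subseteq> D n" "\<forall>p. (\<forall>a\<in>X n. 0 < p a) \<longrightarrow>
      (\<forall>g\<in>G'. 0 < (\<Sum>a\<in>X n. p a * g a)) \<longrightarrow> average X R n p g \<in> indep_prod X R D"
    using add(2) by (elim exE conjE)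
  show ?case
    unfolding eq
  proof (intro exI[of _ "G \<union> G'"] conjI allI impI indep_prod_add)
    fix p
    assume "\<forall>a\<in>X n. 0 < p a" "\<forall>g\<in>G \<union> G'. 0 < (\<Sum>a\<in>X n. p a * g a)"
    then show "average X R n p f \<in> indep_prod X R D" "average X R n p g \<in> indep_prod X R D"
      using G(3) G'(3) by simp_all
  qed (use G G' in auto)
next
  case (scale c f)
  have eq: "average X R n p (\<lambda>z. c * f z) = (\<lambda>x. c * average X R n p f x)" for p
    by (simp add: average_def fun_eq_iff sum_distrib_left mult.left_commute)
  obtain G where "finite G" "G \<subseteq> D n" "\<forall>p. (\<forall>a\<in>X n. 0 < p a) \<longrightarrow>
      (\<forall>g\<in>G. 0 < (\<Sum>a\<in>X n. p a * g a)) \<longrightarrow> average X R n p f \<in> indep_prod X R D"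
    using scale(2) by (elim exE conjE)
  then show ?case
    unfolding eq using scale(1) by (intro exI[of _ G]) (simp add: indep_prod_scale)
qed

section \<open>Cylindrical extension by one variable\<close>

lemma cyl_pos_gambles:
  assumes "n \<notin> R" "X n \<noteq> {}" "f \<in> pos_gambles (PiE R X)"
  shows "cyl X R (insert n R) f \<in> pos_gambles (PiE (insert n R) X)"
proof -
  obtain x where x: "x \<in> PiE R X" "0 < f x"
    using assms by (auto simp: pos_gambles_iff)
  obtain a where "a \<in> X n"
    using assms by auto
  then have "x(n := a) \<in> PiE (insert n R) X" "restrict (x(n := a)) R = x"
    using x assms by (auto simp: PiE_fun_upd PiE_restrict)
  then have "\<exists>z\<in>PiE (insert n R) X. 0 < cyl X R (insert n R) f z"
    using x by (auto simp: cyl_def intro!: bexI[of _ "x(n := a)"])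
  moreover have "restrict z R \<in> PiE R X" if "z \<in> PiE (insert n R) X" for z
    using that by auto
  ultimately show ?thesis
    using assms(3) by (auto simp: pos_gambles_iff gambles_def cyl_def)
qed

text \<open>The cylinder over \<open>y\<close> is the disjoint union of the events
  \<open>y(n := a)\<close>; at a given \<open>z\<close> only \<open>a = z n\<close> can
  contribute.\<close>

lemma cyl_slice:
  assumes "n \<notin> R" "finite (X n)" "r \<in> R" "y \<in> PiE (R - {r}) X"
  shows "cyl X R (insert n R) (slice X R r y g) =
    (\<lambda>z. \<Sum>a\<in>X n. slice X (insert n R) r (y(n := a)) g z)"
proof
  fix z
  show "cyl X R (insert n R) (slice X R r y g) z =
    (\<Sum>a\<in>X n. slice X (insert n R) r (y(n := a)) g z)"
  proof (cases "z \<in> PiE (insert n R) X")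
    case True
    have iff: "restrict z (insert n R - {r}) = y(n := a) \<longleftrightarrow>
        a = z n \<and> restrict z (R - {r}) = y" if "a \<in> X n" for a
    proof -
      have ins: "insert n R - {r} = insert n (R - {r})"
        using assms by auto
      have "y(n := a) \<in> PiE (insert n R - {r}) X"
        using assms that by (auto simp: ins PiE_fun_upd)
      moreover have "restrict (y(n := a)) (R - {r}) = y"
        using assms by (auto simp: PiE_restrict)
      ultimately show ?thesis
        using restrict_upd_eq_iff[OF assms(1,3), of "y(n := a)" X z "z n"] by auto
    qed
    have zR: "restrict z R \<in> PiE R X" "z n \<in> X n"
      using True by auto
    have "restrict (restrict z R) (R - {r}) = restrict z (R - {r})"
      by (auto simp: restrict_def fun_eq_iff)
    then have "cyl X R (insert n R) (slice X R r y g) z =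
        (if restrict z (R - {r}) = y then g (z r) else 0)"
      using True zR assms(3) by (simp add: cyl_def slice_def)
    also have "\<dots> = (\<Sum>a\<in>X n. if a = z n then
        (if restrict z (R - {r}) = y then g (z r) else 0) else 0)"
      using assms(2) zR by simp
    also have "\<dots> = (\<Sum>a\<in>X n. slice X (insert n R) r (y(n := a)) g z)"
      using True by (intro sum.cong) (auto simp: slice_def iff)
    finally show ?thesis .
  next
    case False
    then show ?thesis by (simp add: cyl_def slice_def)
  qed
qed

text \<open>Extension is linear, so generators suffice. Non-emptiness of \<open>X n\<close> keeps
  extended positive gambles non-zero and the sum from \<open>cyl_slice\<close> non-empty.\<close>

lemma cyl_indep_prod:
  assumes "n \<notin> R" "finite (X n)" "X n \<noteq> {}" "f \<in> indep_prod X R D"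
  shows "cyl X R (insert n R) f \<in> indep_prod X (insert n R) D"
  using assms(4)
proof (induction rule: indep_prod_induct)
  case (pos f)
  then show ?case
    using cyl_pos_gambles[of n R X f] assms(1,3) by (simp add: pos_gambles_indep_prod)
next
  case (slice r y g)
  have "y(n := a) \<in> PiE (insert n R - {r}) X" if "a \<in> X n" for a
  proof -
    have "insert n R - {r} = insert n (R - {r})"
      using assms(1) slice by auto
    then show ?thesis
      using slice that by (auto simp: PiE_fun_upd)
  qed
  then have "slice X (insert n R) r (y(n := a)) g \<in> indep_prod X (insert n R) D"
    if "a \<in> X n" for a
    using slice that by (intro slice_indep_prod) auto
  then show ?case
    unfolding cyl_slice[where X = X, OF assms(1,2) slice(1,2)] indep_prod_eq_posi_generators
    using assms(2,3) by (intro posi_sum)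
next
  case (add f g)
  have "cyl X R (insert n R) (\<lambda>z. f z + g z) =
      (\<lambda>z. cyl X R (insert n R) f z + cyl X R (insert n R) g z)"
    by (auto simp: cyl_def)
  then show ?case using indep_prod_add[OF add] by simp
next
  case (scale c f)
  have "cyl X R (insert n R) (\<lambda>z. c * f z) = (\<lambda>z. c * cyl X R (insert n R) f z)"
    by (auto simp: cyl_def)
  then show ?case using indep_prod_scale[OF scale(2,1)] by simp
qed

text \<open>Averaging undoes the extension and stays within the product, for a mass function adapted
  to the given \<open>f\<close>; the converse inclusion is \<open>cyl_indep_prod\<close>.\<close>

lemma marg_indep_prod_insert:
  assumes "n \<notin> R" "finite (X n)" "X n \<noteq> {}" "coherent (X n) (D n)"
  shows "marg X (insert n R) R (indep_prod X (insert n R) D) = indep_prod X R D"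
proof (intro subset_antisym subsetI)
  fix f assume "f \<in> marg X (insert n R) R (indep_prod X (insert n R) D)"
  then have f: "f \<in> gambles (PiE R X)" "cyl X R (insert n R) f \<in> indep_prod X (insert n R) D"
    by (auto simp: marg_def)
  then obtain G where G: "finite G" "G \<subseteq> D n"
      "\<And>p. \<forall>a\<in>X n. 0 < p a \<Longrightarrow> \<forall>g\<in>G. 0 < (\<Sum>a\<in>X n. p a * g a) \<Longrightarrow>
        average X R n p (cyl X R (insert n R) f) \<in> indep_prod X R D"
    using average_indep_prod[where X = X, OF assms(1,2) f(2)] by blast
  obtain p where "\<forall>a\<in>X n. 0 < p a" "(\<Sum>a\<in>X n. p a) = 1"
      "\<forall>g\<in>G. 0 < (\<Sum>a\<in>X n. p a * g a)"
    using coherent_mass_function[OF assms(2-4) G(1,2)] by blast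
  then show "f \<in> indep_prod X R D"
    using G(3)[of p] average_cyl[where X = X, OF assms(1) _ f(1)] by simp
next
  fix f assume "f \<in> indep_prod X R D"
  then show "f \<in> marg X (insert n R) R (indep_prod X (insert n R) D)"
    using cyl_indep_prod[of n R X f D] assms indep_prod_gambles[of X R D]
    by (auto simp: marg_def)
qed

subsection \<open>Removing all variables outside \<open>R\<close>\<close>

lemma marg_self:
  assumes "A \<subseteq> gambles (PiE R X)"
  shows "marg X R R A = A"
proof -
  have "cyl X R R f = f" if "f \<in> gambles (PiE R X)" for f
    using that by (auto simp: cyl_def gambles_def PiE_restrict)
  then show ?thesis
    using assms by (auto simp: marg_def)
qed

text \<open>Cylindrical extension is transitive, so marginalisation can proceed through intermediate
  index sets.\<close>

lemma marg_marg:
  assumes "R \<subseteq> S" "S \<subseteq> N"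
  shows "marg X S R (marg X N S A) = marg X N R A"
proof -
  have "cyl X S N (cyl X R S f) = cyl X R N f" for f
  proof
    fix x
    have "restrict x S \<in> PiE S X" if "x \<in> PiE N X"
      using that assms(2) by auto
    moreover have "restrict (restrict x S) R = restrict x R"
      using assms(1) by (auto simp: restrict_def fun_eq_iff)
    ultimately show "cyl X S N (cyl X R S f) x = cyl X R N f x"
      by (simp add: cyl_def)
  qed
  moreover have "cyl X R S f \<in> gambles (PiE S X)" for f
    by (simp add: cyl_def gambles_def)
  ultimately show ?thesis
    by (simp add: marg_def)
qed

theorem proposition17:
  fixes N R :: "'i set" and X :: "'i \<Rightarrow> 'a set" and D :: "'i \<Rightarrow> ('a \<Rightarrow> real) set"
  assumes "finite N" and "N \<noteq> {}"
    and "\<And>n. n \<in> N \<Longrightarrow> finite (X n)"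
    and "\<And>n. n \<in> N \<Longrightarrow> X n \<noteq> {}"
    and "\<And>n. n \<in> N \<Longrightarrow> coherent (X n) (D n)"
    and "R \<subseteq> N"
  shows "marg X N R (indep_prod X N D) = indep_prod X R D"
proof -
  \<comment> \<open>Induction on the set \<open>M\<close> of variables to be removed;
    \<open>M = N - R\<close> gives the theorem.\<close>
  have "marg X (R \<union> M) R (indep_prod X (R \<union> M) D) = indep_prod X R D"
    if "finite M" "M \<subseteq> N - R" for M
    using that
  proof (induction M rule: finite_induct)
    case empty
    then show ?case
      by (simp add: marg_self indep_prod_gambles)
  next
    case (insert n M)
    let ?S = "R \<union> M"
    have "marg X (insert n ?S) R (indep_prod X (insert n ?S) D) =
        marg X ?S R (marg X (insert n ?S) ?S (indep_prod X (insert n ?S) D))"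
      by (rule marg_marg[symmetric]) auto
    also have "\<dots> = marg X ?S R (indep_prod X ?S D)"
      using insert assms by (subst marg_indep_prod_insert) auto
    also have "\<dots> = indep_prod X R D"
      using insert by simp
    finally show ?case by simp
  qed
  from this[of "N - R"] show ?thesis
    using assms(1,6) by (simp add: Un_absorb1 Un_Diff_cancel)
qed

end
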